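(* One has $\mathrm{int}(\overline{\mathbb H}_N)=\mathrm{int}(\mathbb H_N)\subsetneq\mathrm{int}(\mathbb H_\mu)\subsetneq\mathrm{int}(\overline{\mathbb H}_\mu)=\mathbb H$.
   Context: $\mathbb D$ is the open unit disc in $\mathbb C$, $\overline{\mathbb D}$ its closure; $\mathrm{int}(\cdot)$ and overlines denote interior and closure in $\mathbb C^4$; $\|\cdot\|$ is the operator norm on $M_2(\mathbb C)$ induced by the Euclidean norm on $\mathbb C^2$. Let $E\subset M_2(\mathbb C)$ be the linear space of all upper triangular matrices. For $A\in M_2(\mathbb C)$, $$\mu_{\mathrm{hexa}}(A)=\frac{1}{\inf\{\|X\| : X\in E,\ \det(I-AX)=0\}},$$ with $\mu_{\mathrm{hexa}}(A)=0$ if $\det(I-AX)\ne0$ for all $X\in E$. $\pi:M_2(\mathbb C)\to\mathbb C^4$ is $\pi((a_{ij}))=(a_{21},a_{11},a_{22},\det(A))$; $\mathbb H_\mu=\{\pi(A): A\in M_2(\mathbb C),\ \mu_{\mathrm{hexa}}(A)<1\}$; $\mathbb H_N=\{\pi(A): A\in M_2(\mathbb C),\ \|A\|<1\}$. The tetrablock is $\mathbb E=\{(x_1,x_2,x_3)\in\mathbb C^3: 1-x_1z_1-x_2z_2+x_3z_1z_2\ne0 \text{ for all } z_1,z_2\in\overline{\mathbb D}\}$. The hexablock is $$\mathbb H=\left\{(a,x_1,x_2,x_3)\in\mathbb C\times\mathbb E:\ \sup_{z_1,z_2\in\mathbb D}\left|\frac{a\sqrt{(1-|z_1|^2)(1-|z_2|^2)}}{1-x_1z_1-x_2z_2+x_3z_1z_2}\right|<1\right\}.$$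 *)

theory Defs
  imports "HOL-Analysis.Analysis"
begin

text \<open>Points of $\mathbb{C}^n$ ($n = 3, 4$) are tuples; the norm on product types is the Euclidean one,
  so \<^const>\<open>interior\<close> and \<^const>\<open>closure\<close> are the usual ones. Matrices are indexed by type 2,
  and \<^const>\<open>norm\<close> on \<^typ>\<open>complex^2\<close> is the Euclidean norm.\<close>

definition opnorm :: "complex^2^2 \<Rightarrow> real" where
  "opnorm A = onorm (\<lambda>v. A *v v)"

definition upper_triangular2 :: "(complex^2^2) set" where
  "upper_triangular2 = {X. X $ 2 $ 1 = 0}"

definition mu_hexa :: "complex^2^2 \<Rightarrow> real" where
  "mu_hexa A =
     (if \<forall>X\<in>upper_triangular2. det (mat 1 - A ** X) \<noteq> 0 then 0
      else 1 / Inf {opnorm X | X. X \<in> upper_triangular2 \<and> det (mat 1 - A ** X) = 0})"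

definition pi_hexa :: "complex^2^2 \<Rightarrow> complex \<times> complex \<times> complex \<times> complex" where
  "pi_hexa A = (A $ 2 $ 1, A $ 1 $ 1, A $ 2 $ 2, det A)"

definition H_mu :: "(complex \<times> complex \<times> complex \<times> complex) set" where
  "H_mu = {pi_hexa A | A. mu_hexa A < 1}"

definition H_N :: "(complex \<times> complex \<times> complex \<times> complex) set" where
  "H_N = {pi_hexa A | A. opnorm A < 1}"

definition tetrablock :: "(complex \<times> complex \<times> complex) set" where
  "tetrablock = {(x1, x2, x3).
     \<forall>z1\<in>cball 0 1. \<forall>z2\<in>cball 0 1. 1 - x1 * z1 - x2 * z2 + x3 * z1 * z2 \<noteq> 0}"

text \<open>The real-valued supremum is meaningful here: for $x$ in the tetrablock the denominator is
  continuous without zeros on the compact closed bidisc, so the family is bounded.\<close>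

definition hexablock :: "(complex \<times> complex \<times> complex \<times> complex) set" where
  "hexablock = {(a, x1, x2, x3). (x1, x2, x3) \<in> tetrablock \<and>
     (SUP (z1, z2) \<in> ball 0 1 \<times> ball 0 1.
        cmod (a * of_real (sqrt ((1 - (cmod z1)\<^sup>2) * (1 - (cmod z2)\<^sup>2)))
              / (1 - x1 * z1 - x2 * z2 + x3 * z1 * z2))) < 1}"

end

theory Submission
  imports Defs
begin

text \<open>
  An upper triangular contraction is determined by diagonal entries \<open>z1\<close>, \<open>z2\<close> in the closed disc
  and a corner entry \<open>q\<close> of modulus at most \<open>w = sqrt ((1 - |z1|\<^sup>2) * (1 - |z2|\<^sup>2))\<close>
  (\<open>upper_triangular_contraction_iff\<close>). For such an \<open>X\<close> and a matrix \<open>A\<close> with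
  image \<open>(a, x1, x2, x3)\<close> one has
  \<open>det (I - A X) = (1 - x1 * z1 - x2 * z2 + x3 * z1 * z2) - a * q\<close>. The phase of \<open>q\<close> being free,
  no upper triangular contraction annihilates this determinant exactly when the modulus of the
  bracket exceeds \<open>|a| * w\<close> on the whole closed bidisc, and that is the defining condition of the
  hexablock (\<open>hexablock_iff_gap_pos\<close>). Hence \<open>mu_hexa A < 1\<close> iff the image of \<open>A\<close> lies in the
  hexablock (\<open>mu_hexa_less_1_iff\<close>).

  So \<open>H_mu\<close> is the part of the hexablock inside the range of \<open>pi_hexa\<close>, and that range consists of the
  points with \<open>a \<noteq> 0\<close> or \<open>x3 = x1 * x2\<close>. A point with \<open>a = 0\<close> is never interior to the range, since
  moving \<open>x3\<close> leaves it, while the points with \<open>a \<noteq> 0\<close> are dense in the open hexablock. Therefore the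
  interior of \<open>H_mu\<close> is the hexablock without \<open>a = 0\<close>; it misses the origin, and \<open>H_mu\<close> has the same
  closure as the hexablock.

  Scaling of matrices by \<open>t\<close> becomes the dilation \<open>(t a, t x1, t x2, t\<^sup>2 x3)\<close>, and it settles the two
  statements about interiors of closures. An interior point of a closure can be dilated by some
  \<open>t > 1\<close> without leaving the closure, and the gain in strictness on the way back puts it into
  the set itself: for the hexablock because dilation by \<open>r < 1\<close> maps its closure into it
  (\<open>hexa_dilate_closure_hexablock\<close>), for \<open>H_N\<close> because its closure consists of images of
  contractions, and \<open>t * A\<close> being a contraction makes the norm of \<open>A\<close> at most \<open>1 / t\<close>.

  Finally \<open>H_N\<close> lies in \<open>H_mu\<close> because a product of a strict contraction and a contraction cannot have
  eigenvalue 1. A small \<open>a\<close> with a sizeable \<open>x3\<close> forces a large upper right entry, and this separates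
  the interiors.
\<close>

section \<open>The operator norm of two-by-two matrices\<close>

lemma norm_mult_vec_le: "norm (A *v v) \<le> opnorm A * norm v"
  unfolding opnorm_def by (rule onorm[OF matrix_vector_mul_bounded_linear])

lemma opnorm_le_iff:
  assumes "0 \<le> c"
  shows "opnorm A \<le> c \<longleftrightarrow> (\<forall>v. norm (A *v v) \<le> c * norm v)"
proof
  assume "opnorm A \<le> c"
  show "\<forall>v. norm (A *v v) \<le> c * norm v"
  proof
    fix v
    have "norm (A *v v) \<le> opnorm A * norm v"
      by (rule norm_mult_vec_le)
    also have "\<dots> \<le> c * norm v"
      using \<open>opnorm A \<le> c\<close> by (rule mult_right_mono) simp
    finally show "norm (A *v v) \<le> c * norm v" .
  qed
next
  assume "\<forall>v. norm (A *v v) \<le> c * norm v"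
  then show "opnorm A \<le> c"
    unfolding opnorm_def using assms by (intro onorm_bound) auto
qed

lemma opnorm_nonneg: "0 \<le> opnorm A"
  unfolding opnorm_def by (rule onorm_pos_le[OF matrix_vector_mul_bounded_linear])

lemma scaleR_matrix_vector: "(t *\<^sub>R A) *v v = t *\<^sub>R (A *v v)" for A :: "complex^2^2"
  by (simp add: vec_eq_iff matrix_vector_mult_def scaleR_sum_right)

lemma opnorm_scaleR: "opnorm (t *\<^sub>R A) = \<bar>t\<bar> * opnorm A"
  unfolding opnorm_def scaleR_matrix_vector
  by (rule onorm_scaleR[OF matrix_vector_mul_bounded_linear])

lemma compact_opnorm_cball: "compact {A. opnorm A \<le> r}"
proof (cases "0 \<le> r")
  case True
  have entry: "norm (A $ i $ j) \<le> r" if "opnorm A \<le> r" for A i j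
  proof -
    have "norm (A $ i $ j) \<le> norm (A *v axis j 1)"
      using Finite_Cartesian_Product.norm_nth_le[of "A *v axis j 1" i]
      by (simp add: matrix_vector_mult_def axis_def if_distrib cong: if_cong)
    also have "\<dots> \<le> r"
      using opnorm_le_iff[OF True, of A] that by (auto dest: spec[of _ "axis j 1"])
    finally show ?thesis .
  qed
  have row: "norm (A $ i) \<le> (\<Sum>j\<in>(UNIV::2 set). r)" if "opnorm A \<le> r" for A i
    unfolding norm_vec_def[of "A $ i"]
    by (rule order_trans[OF L2_set_le_sum sum_mono]) (auto intro: entry[OF that])
  have "norm A \<le> (\<Sum>i\<in>(UNIV::2 set). \<Sum>j\<in>(UNIV::2 set). r)" if "opnorm A \<le> r" for A
    unfolding norm_vec_def[of A]
    by (rule order_trans[OF L2_set_le_sum sum_mono]) (auto intro: row[OF that] simp del: sum_constant)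
  then have "bounded {A. opnorm A \<le> r}"
    by (auto simp only: bounded_iff mem_Collect_eq)
  moreover have "closed {A. opnorm A \<le> r}"
  proof -
    have "{A. opnorm A \<le> r} = (\<Inter>v. {A. norm (A *v v) \<le> r * norm v})"
      using opnorm_le_iff[OF True] by auto
    moreover have "continuous_on UNIV (\<lambda>A::complex^2^2. A *v v)" for v
      unfolding matrix_vector_mult_def by (intro continuous_intros)
    ultimately show ?thesis
      by (auto intro!: closed_INT closed_Collect_le continuous_intros)
  qed
  ultimately show ?thesis
    by (simp add: compact_eq_bounded_closed)
next
  case False
  then have "{A. opnorm A \<le> r} = {}"
    using opnorm_nonneg by (auto intro: order_trans)
  then show ?thesis by simp
qed

text \<open>A kernel vector of \<open>I - A X\<close> would be fixed by \<open>A X\<close>, which strictly shrinks every nonzero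
  vector.\<close>

lemma det_one_minus_mult_neq_0:
  assumes "opnorm A * opnorm X < 1"
  shows "det (mat 1 - A ** X) \<noteq> 0"
proof
  assume "det (mat 1 - A ** X) = 0"
  then have "\<not> invertible (mat 1 - A ** X)"
    by (simp add: invertible_det_nz)
  then obtain v where "v \<noteq> 0" "(mat 1 - A ** X) *v v = 0"
    using matrix_left_invertible_ker[of "mat 1 - A ** X"]
    by (auto simp: invertible_left_inverse)
  then have "v = A *v (X *v v)"
    by (simp add: matrix_vector_mult_diff_rdistrib matrix_vector_mul_assoc)
  then have "norm v \<le> opnorm A * norm (X *v v)"
    by (metis norm_mult_vec_le)
  also have "\<dots> \<le> opnorm A * (opnorm X * norm v)"
    by (intro mult_left_mono norm_mult_vec_le opnorm_nonneg)
  also have "\<dots> < 1 * norm v"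
    using assms \<open>v \<noteq> 0\<close> by (simp flip: mult.assoc)
  finally show False by simp
qed

lemma norm_vec2_squared: "(norm v)\<^sup>2 = (cmod (v $ 1))\<^sup>2 + (cmod (v $ 2))\<^sup>2" for v :: "complex^2"
  by (simp add: norm_vec_def L2_set_def UNIV_2)

lemma upper_triangular_norm_squared:
  assumes "X \<in> upper_triangular2"
  shows "(norm (X *v v))\<^sup>2 = (cmod (X$1$1 * v$1 + X$1$2 * v$2))\<^sup>2 + (cmod (X$2$2))\<^sup>2 * (cmod (v$2))\<^sup>2"
  using assms
  by (simp add: norm_vec2_squared matrix_vector_mult_def UNIV_2 upper_triangular2_def
      norm_mult power_mult_distrib)

text \<open>This is the condition that \<open>I - X\<^sup>* X\<close> be positive semidefinite, written out with the
  entries. The forward direction tests the contraction property on the first unit vector and on one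
  two-parameter family of vectors; completing a square gives the converse.\<close>

lemma upper_triangular_contraction_iff:
  assumes X: "X \<in> upper_triangular2"
  shows "opnorm X \<le> 1 \<longleftrightarrow> cmod (X$1$1) \<le> 1 \<and> cmod (X$2$2) \<le> 1 \<and>
    (cmod (X$1$2))\<^sup>2 \<le> (1 - (cmod (X$1$1))\<^sup>2) * (1 - (cmod (X$2$2))\<^sup>2)"
proof -
  define p q r where "p = X$1$1" and "q = X$1$2" and "r = X$2$2"
  define P Q R where "P = cmod p" and "Q = cmod q" and "R = cmod r"
  have PQR: "0 \<le> P" "0 \<le> Q" "0 \<le> R"
    by (simp_all add: P_def Q_def R_def)
  have "opnorm X \<le> 1 \<longleftrightarrow> (\<forall>v. (norm (X *v v))\<^sup>2 \<le> (norm v)\<^sup>2)"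
    using opnorm_le_iff[of 1 X] by simp
  also have "\<dots> \<longleftrightarrow> (\<forall>u w. (cmod (p * u + q * w))\<^sup>2 + R\<^sup>2 * (cmod w)\<^sup>2 \<le> (cmod u)\<^sup>2 + (cmod w)\<^sup>2)"
    (is "_ \<longleftrightarrow> ?C")
  proof safe
    fix u w
    assume "\<forall>v. (norm (X *v v))\<^sup>2 \<le> (norm v)\<^sup>2"
    from this[rule_format, of "vector [u, w]"]
    show "(cmod (p * u + q * w))\<^sup>2 + R\<^sup>2 * (cmod w)\<^sup>2 \<le> (cmod u)\<^sup>2 + (cmod w)\<^sup>2"
      unfolding upper_triangular_norm_squared[OF X] norm_vec2_squared[of "vector [u, w]"]
      by (simp add: p_def q_def r_def R_def)
  next
    fix v
    assume ?C
    then show "(norm (X *v v))\<^sup>2 \<le> (norm v)\<^sup>2"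
      unfolding upper_triangular_norm_squared[OF X] norm_vec2_squared[of v]
      by (simp add: p_def q_def r_def R_def)
  qed
  also have "\<dots> \<longleftrightarrow> P \<le> 1 \<and> R \<le> 1 \<and> Q\<^sup>2 \<le> (1 - P\<^sup>2) * (1 - R\<^sup>2)"
  proof
    assume C: ?C
    have "P\<^sup>2 \<le> 1\<^sup>2"
      using C[rule_format, of 1 0] by (simp add: P_def)
    then have P1: "P \<le> 1"
      by (rule power2_le_imp_le) simp
    have pcp: "p * cnj p = of_real (P\<^sup>2)"
      unfolding P_def complex_norm_square ..
    (* The first entry of a test vector is a real multiple of cnj p * q, so that the two summands of
       the first entry of its image have the same phase and their moduli add up. *)
    have key: "(Q * (P\<^sup>2 * s + t))\<^sup>2 + R\<^sup>2 * t\<^sup>2 \<le> (P * Q * s)\<^sup>2 + t\<^sup>2"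
      for s t :: real
    proof -
      have "p * (cnj p * q * of_real s) + q * of_real t = q * of_real (P\<^sup>2 * s + t)"
        using pcp by (simp add: algebra_simps)
      then show ?thesis
        using C[rule_format, of "cnj p * q * of_real s" "of_real t"]
        by (simp only: norm_mult norm_of_real complex_mod_cnj P_def Q_def power_mult_distrib
            power2_abs)
    qed
    show "P \<le> 1 \<and> R \<le> 1 \<and> Q\<^sup>2 \<le> (1 - P\<^sup>2) * (1 - R\<^sup>2)"
    proof (cases "P = 1")
      case True
      have "Q = 0"
      proof (rule ccontr)
        assume "Q \<noteq> 0"
        (* For P = 1 the form |v|^2 - |X v|^2 is indefinite unless Q = 0; s = 1, t = Q^2 is a direction
           in which it is negative. *)
        have "(Q * (1 + Q\<^sup>2))\<^sup>2 + R\<^sup>2 * (Q\<^sup>2)\<^sup>2 \<le> Q\<^sup>2 + (Q\<^sup>2)\<^sup>2"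
          using key[of 1 "Q\<^sup>2"] by (simp add: True)
        moreover have "(Q * (1 + Q\<^sup>2))\<^sup>2 = Q\<^sup>2 + (Q\<^sup>2)\<^sup>2 + (Q\<^sup>2)\<^sup>2 + (Q^3)\<^sup>2"
          by (simp add: power2_eq_square power3_eq_cube algebra_simps)
        moreover have "0 \<le> R\<^sup>2 * (Q\<^sup>2)\<^sup>2" "0 < (Q\<^sup>2)\<^sup>2" "0 \<le> (Q^3)\<^sup>2"
          using \<open>Q \<noteq> 0\<close> by simp_all
        ultimately show False by linarith
      qed
      moreover from this have "R\<^sup>2 \<le> 1\<^sup>2"
        using key[of 0 1] by simp
      then have "R \<le> 1"
        by (rule power2_le_imp_le) simp
      ultimately show ?thesis
        using True by simp
    next
      case False
      with P1 PQR have d: "0 < 1 - P\<^sup>2"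
        by (simp add: power_less_one_iff abs_square_less_1)
      (* In the direction s = 1, t = 1 - P^2 the square that is completed in the converse vanishes,
         so that only the determinant condition is left. *)
      have "Q\<^sup>2 + R\<^sup>2 * (1 - P\<^sup>2)\<^sup>2 \<le> P\<^sup>2 * Q\<^sup>2 + (1 - P\<^sup>2)\<^sup>2"
        using key[of 1 "1 - P\<^sup>2"] by (simp add: power_mult_distrib)
      then have "(1 - P\<^sup>2) * Q\<^sup>2 \<le> (1 - P\<^sup>2) * ((1 - P\<^sup>2) * (1 - R\<^sup>2))"
        by (simp add: power2_eq_square algebra_simps)
      with d have Q: "Q\<^sup>2 \<le> (1 - P\<^sup>2) * (1 - R\<^sup>2)"
        by simp
      then have "0 \<le> (1 - P\<^sup>2) * (1 - R\<^sup>2)"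
        using zero_le_power2[of Q] by linarith
      with d have "R\<^sup>2 \<le> 1\<^sup>2"
        by (simp add: zero_le_mult_iff)
      then have "R \<le> 1"
        by (rule power2_le_imp_le) simp
      with P1 Q show ?thesis by simp
    qed
  next
    assume A: "P \<le> 1 \<and> R \<le> 1 \<and> Q\<^sup>2 \<le> (1 - P\<^sup>2) * (1 - R\<^sup>2)"
    show ?C
    proof (intro allI)
      fix u w
      define U W where "U = cmod u" and "W = cmod w"
      have "cmod (p * u + q * w) \<le> P * U + Q * W"
        unfolding P_def Q_def U_def W_def by (metis norm_mult norm_triangle_ineq)
      then have "(cmod (p * u + q * w))\<^sup>2 \<le> (P * U + Q * W)\<^sup>2"
        by (rule power_mono) simp
      moreover have "(P * U + Q * W)\<^sup>2 + R\<^sup>2 * W\<^sup>2 \<le> U\<^sup>2 + W\<^sup>2"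
      proof (cases "P = 1")
        case True
        with A have "Q = 0" "R\<^sup>2 \<le> 1"
          using PQR by (auto simp: power_le_one)
        then show ?thesis
          using True mult_right_mono[of "R\<^sup>2" 1 "W\<^sup>2"] by simp
      next
        case False
        with A PQR have d: "0 < 1 - P\<^sup>2"
          by (simp add: power_less_one_iff abs_square_less_1)
        have "0 \<le> ((1 - P\<^sup>2) * U - P * Q * W)\<^sup>2 + ((1 - P\<^sup>2) * (1 - R\<^sup>2) - Q\<^sup>2) * W\<^sup>2"
          using A by (intro add_nonneg_nonneg mult_nonneg_nonneg) auto
        also have "\<dots> = (1 - P\<^sup>2) * (U\<^sup>2 + W\<^sup>2 - ((P * U + Q * W)\<^sup>2 + R\<^sup>2 * W\<^sup>2))"
          by (simp add: power2_eq_square algebra_simps)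
        finally show ?thesis
          using d by (simp add: zero_le_mult_iff)
      qed
      ultimately show "(cmod (p * u + q * w))\<^sup>2 + R\<^sup>2 * (cmod w)\<^sup>2 \<le> (cmod u)\<^sup>2 + (cmod w)\<^sup>2"
        by (simp add: U_def W_def)
    qed
  qed
  finally show ?thesis
    by (simp add: P_def Q_def R_def p_def q_def r_def)
qed

section \<open>The hexablock as an open condition on the closed bidisc\<close>

abbreviation closed_bidisc :: "(complex \<times> complex) set" where
  "closed_bidisc \<equiv> cball 0 1 \<times> cball 0 1"

text \<open>The polynomial whose zeros define the tetrablock. It takes the whole quadruple, because the
  dilation used below acts on quadruples.\<close>

definition tetra_den :: "complex \<times> complex \<times> complex \<times> complex \<Rightarrow> complex \<times> complex \<Rightarrow> complex" where
  "tetra_den y z = 1 - fst (snd y) * fst z - fst (snd (snd y)) * snd z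
     + snd (snd (snd y)) * fst z * snd z"

definition bidisc_weight :: "complex \<times> complex \<Rightarrow> real" where
  "bidisc_weight z = sqrt ((1 - (cmod (fst z))\<^sup>2) * (1 - (cmod (snd z))\<^sup>2))"

definition hexa_gap :: "complex \<times> complex \<times> complex \<times> complex \<Rightarrow> complex \<times> complex \<Rightarrow> real" where
  "hexa_gap y z = cmod (tetra_den y z) - cmod (fst y) * bidisc_weight z"

lemma tetra_den_tuple [simp]:
  "tetra_den (a, x1, x2, x3) (z1, z2) = 1 - x1 * z1 - x2 * z2 + x3 * z1 * z2"
  by (simp add: tetra_den_def)

lemma bidisc_weight_nonneg: "z \<in> closed_bidisc \<Longrightarrow> 0 \<le> bidisc_weight z"
  by (auto simp: bidisc_weight_def power_le_one)

lemma hexa_gap_pos_imp_den_neq_0: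
  assumes "0 < hexa_gap y z" "z \<in> closed_bidisc"
  shows "tetra_den y z \<noteq> 0"
proof -
  have "0 \<le> cmod (fst y) * bidisc_weight z"
    by (intro mult_nonneg_nonneg bidisc_weight_nonneg assms) simp
  with assms(1) show ?thesis
    by (auto simp: hexa_gap_def)
qed

text \<open>The supremum over the open bidisc is replaced by a pointwise strict inequality on the closed one.
  The quotient is continuous on the compact closed bidisc, so it attains its maximum there; at boundary
  points the weight vanishes, and the inequality only says that the denominator is nonzero.\<close>

lemma hexablock_iff_gap_pos: "y \<in> hexablock \<longleftrightarrow> (\<forall>z\<in>closed_bidisc. 0 < hexa_gap y z)"
proof -
  obtain a x1 x2 x3 where y: "y = (a, x1, x2, x3)"
    by (cases y)
  define g where "g z = cmod a * bidisc_weight z / cmod (tetra_den y z)" for z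
  have hexa: "y \<in> hexablock \<longleftrightarrow>
      (\<forall>z\<in>closed_bidisc. tetra_den y z \<noteq> 0) \<and> (SUP z\<in>ball 0 1 \<times> ball 0 1. g z) < 1"
  proof -
    have "(SUP z\<in>ball 0 1 \<times> ball 0 1. g z) = (SUP (z1, z2) \<in> ball 0 1 \<times> ball 0 1.
        cmod (a * of_real (sqrt ((1 - (cmod z1)\<^sup>2) * (1 - (cmod z2)\<^sup>2)))
              / (1 - x1 * z1 - x2 * z2 + x3 * z1 * z2)))"
      by (intro SUP_cong refl)
        (auto simp: g_def y bidisc_weight_def norm_mult norm_divide abs_square_le_1)
    then show ?thesis
      by (auto simp: hexablock_def tetrablock_def y)
  qed
  have gap: "0 < hexa_gap y z \<longleftrightarrow> g z < 1" if "tetra_den y z \<noteq> 0" for z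
    using that by (simp add: hexa_gap_def g_def y)
  have cont: "continuous_on closed_bidisc g" if "\<forall>z\<in>closed_bidisc. tetra_den y z \<noteq> 0"
    using that unfolding g_def tetra_den_def bidisc_weight_def
    by (intro continuous_intros) auto
  have comp: "compact closed_bidisc"
    by (intro compact_Times compact_cball)
  have sub: "ball 0 1 \<times> ball 0 1 \<subseteq> closed_bidisc"
    by auto
  show ?thesis
  proof
    assume "y \<in> hexablock"
    then have den: "\<forall>z\<in>closed_bidisc. tetra_den y z \<noteq> 0"
      and sup: "(SUP z\<in>ball 0 1 \<times> ball 0 1. g z) < 1"
      by (auto simp: hexa)
    have "bdd_above (g ` closed_bidisc)"
      using compact_continuous_image[OF cont[OF den] comp]
      by (intro bounded_imp_bdd_above compact_imp_bounded)
    then have bdd: "bdd_above (g ` (ball 0 1 \<times> ball 0 1))"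
      by (rule bdd_above_mono) (use sub in blast)
    show "\<forall>z\<in>closed_bidisc. 0 < hexa_gap y z"
    proof
      fix z :: "complex \<times> complex" assume z: "z \<in> closed_bidisc"
      show "0 < hexa_gap y z"
      proof (cases "z \<in> ball 0 1 \<times> ball 0 1")
        case True
        then have "g z \<le> (SUP z\<in>ball 0 1 \<times> ball 0 1. g z)"
          by (intro cSUP_upper bdd)
        with sup gap den z show ?thesis by auto
      next
        case False
        with z have "cmod (fst z) = 1 \<or> cmod (snd z) = 1"
          by (cases z) auto
        then have "bidisc_weight z = 0"
          by (auto simp: bidisc_weight_def)
        with bspec[OF den z] show ?thesis
          by (simp add: hexa_gap_def)
      qed
    qed
  next
    assume pos: "\<forall>z\<in>closed_bidisc. 0 < hexa_gap y z"
    have den: "\<forall>z\<in>closed_bidisc. tetra_den y z \<noteq> 0"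
      using pos hexa_gap_pos_imp_den_neq_0 by blast
    obtain w where w: "w \<in> closed_bidisc" "\<forall>z\<in>closed_bidisc. g z \<le> g w"
      using continuous_attains_sup[OF comp _ cont[OF den]] by auto
    have "(SUP z\<in>ball 0 1 \<times> ball 0 1. g z) \<le> g w"
      using w sub by (intro cSUP_least) auto
    also have "g w < 1"
      using pos w gap den by blast
    finally show "y \<in> hexablock"
      using den by (simp add: hexa)
  qed
qed

text \<open>A condition that is open in both variables remains open when it is required for all points of
  a compact set: the complement is the projection of a closed set along the bidisc.\<close>

lemma open_hexablock: "open hexablock"
proof -
  have "closed {y. \<exists>z. z \<in> closed_bidisc \<and> (z, y) \<in> {p. hexa_gap (snd p) (fst p) \<le> 0}}"
    unfolding hexa_gap_def tetra_den_def bidisc_weight_def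
    by (intro closed_compact_projection compact_Times compact_cball closed_Collect_le
        continuous_intros)
  moreover have "{y. \<exists>z. z \<in> closed_bidisc \<and> (z, y) \<in> {p. hexa_gap (snd p) (fst p) \<le> 0}} = - hexablock"
    unfolding set_eq_iff mem_Collect_eq Compl_iff hexablock_iff_gap_pos fst_conv snd_conv
    by (metis not_less)
  ultimately show ?thesis
    by (simp add: open_closed)
qed

section \<open>The weighted dilation\<close>

text \<open>The last coordinate has weight two because it is a determinant.\<close>

definition hexa_dilate :: "real \<Rightarrow> complex \<times> complex \<times> complex \<times> complex \<Rightarrow> complex \<times> complex \<times> complex \<times> complex" where
  "hexa_dilate t y = (t *\<^sub>R fst y, t *\<^sub>R fst (snd y), t *\<^sub>R fst (snd (snd y)), t\<^sup>2 *\<^sub>R snd (snd (snd y)))"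

lemma hexa_dilate_dilate: "hexa_dilate s (hexa_dilate t y) = hexa_dilate (s * t) y"
  by (simp add: hexa_dilate_def power_mult_distrib)

lemma hexa_dilate_one [simp]: "hexa_dilate 1 y = y"
  by (simp add: hexa_dilate_def)

lemma fst_hexa_dilate [simp]: "fst (hexa_dilate t y) = t *\<^sub>R fst y"
  by (simp add: hexa_dilate_def)

lemma pi_hexa_scaleR: "pi_hexa (t *\<^sub>R A) = hexa_dilate t (pi_hexa A)"
  by (simp add: pi_hexa_def hexa_dilate_def det_2 power2_eq_square algebra_simps)

text \<open>Interior points are turned into strict inequalities by means of this lemma: it provides room for a
  dilation factor strictly above 1.\<close>

lemma open_hexa_dilate_outward:
  assumes "open S" "y \<in> S"
  obtains t where "1 < t" "hexa_dilate t y \<in> S"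
proof -
  have "((\<lambda>t. hexa_dilate t y) \<longlongrightarrow> hexa_dilate 1 y) (at_right 1)"
    unfolding hexa_dilate_def by (intro tendsto_intros)
  then have "\<forall>\<^sub>F t in at_right 1. hexa_dilate t y \<in> S"
    using assms by (auto dest: topological_tendstoD)
  moreover have "\<forall>\<^sub>F t in at_right (1::real). 1 < t"
    by (simp add: eventually_at_right_less)
  ultimately have "\<forall>\<^sub>F t in at_right 1. 1 < t \<and> hexa_dilate t y \<in> S"
    by eventually_elim simp
  then show ?thesis
    using that eventually_happens'[OF trivial_limit_at_right_real] by blast
qed

lemma tetra_den_hexa_dilate:
  "tetra_den (hexa_dilate t y) z = tetra_den y (t *\<^sub>R z)"
  by (simp add: tetra_den_def hexa_dilate_def power2_eq_square)

text \<open>These are closed consequences of the absence of zeros of \<open>tetra_den\<close>, obtained by solving for one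
  variable. Unlike the absence of zeros itself, they pass to the closure of the hexablock.\<close>

lemma hexablock_coefficient_bounds:
  assumes "(a, x1, x2, x3) \<in> hexablock"
  shows "cmod x2 \<le> 1" and "cmod z \<le> 1 \<Longrightarrow> cmod (x1 - x3 * z) \<le> cmod (1 - x2 * z)"
proof -
  have den: "1 - x1 * z1 - x2 * z2 + x3 * z1 * z2 \<noteq> 0" if "cmod z1 \<le> 1" "cmod z2 \<le> 1" for z1 z2
    using assms that hexa_gap_pos_imp_den_neq_0[of "(a, x1, x2, x3)" "(z1, z2)"]
    by (auto simp: hexablock_iff_gap_pos)
  show "cmod x2 \<le> 1"
  proof (rule ccontr)
    assume "\<not> cmod x2 \<le> 1"
    then have "x2 \<noteq> 0" "cmod (1 / x2) \<le> 1"
      by (auto simp: norm_divide divide_le_eq)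
    with den[of 0 "1 / x2"] show False by simp
  qed
  show "cmod (x1 - x3 * z) \<le> cmod (1 - x2 * z)" if "cmod z \<le> 1"
  proof (rule ccontr)
    assume less: "\<not> cmod (x1 - x3 * z) \<le> cmod (1 - x2 * z)"
    then have "x1 - x3 * z \<noteq> 0"
      by auto
    define z1 where "z1 = (1 - x2 * z) / (x1 - x3 * z)"
    have "cmod z1 \<le> 1"
      using less \<open>x1 - x3 * z \<noteq> 0\<close> by (simp add: z1_def norm_divide)
    moreover have "1 - x1 * z1 - x2 * z + x3 * z1 * z = (1 - x2 * z) - z1 * (x1 - x3 * z)"
      by (simp add: algebra_simps)
    moreover have "\<dots> = 0"
      using \<open>x1 - x3 * z \<noteq> 0\<close> by (simp add: z1_def)
    ultimately show False
      using den[OF _ that] by metis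
  qed
qed

text \<open>Limits of the zero-free polynomials remain zero-free in the open bidisc. As they are affine in
  each variable, the bounds above take the place of Hurwitz's theorem: a zero with \<open>|w1| < 1\<close> forces
  \<open>1 - x2 * w2 = 0\<close>, which contradicts \<open>|x2| \<le> 1\<close> and \<open>|w2| < 1\<close>.\<close>

lemma tetra_den_neq_0_closure_hexablock:
  assumes y: "y \<in> closure hexablock" and w: "cmod (fst w) < 1" "cmod (snd w) < 1"
  shows "tetra_den y w \<noteq> 0"
proof
  obtain a x1 x2 x3 where y_eq: "y = (a, x1, x2, x3)"
    by (cases y)
  obtain w1 w2 where w_eq: "w = (w1, w2)"
    by (cases w)
  assume zero: "tetra_den y w = 0"
  have "closure hexablock \<subseteq> {y. cmod (fst (snd (snd y))) \<le> 1}"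
    by (intro closure_minimal closed_Collect_le continuous_intros)
      (auto dest: hexablock_coefficient_bounds(1))
  with y have x2: "cmod x2 \<le> 1"
    by (auto simp: y_eq)
  have "closure hexablock \<subseteq>
      {y. cmod (fst (snd y) - snd (snd (snd y)) * w2) \<le> cmod (1 - fst (snd (snd y)) * w2)}"
    using w by (intro closure_minimal closed_Collect_le continuous_intros)
      (auto simp: w_eq intro!: hexablock_coefficient_bounds(2))
  with y have le: "cmod (x1 - x3 * w2) \<le> cmod (1 - x2 * w2)"
    by (auto simp: y_eq)
  have eq: "1 - x2 * w2 = w1 * (x1 - x3 * w2)"
    using zero by (simp add: y_eq w_eq algebra_simps)
  have "1 - x2 * w2 = 0"
  proof (rule ccontr)
    assume "1 - x2 * w2 \<noteq> 0"
    have "cmod (1 - x2 * w2) = cmod w1 * cmod (x1 - x3 * w2)"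
      by (simp add: eq norm_mult)
    also have "\<dots> \<le> cmod w1 * cmod (1 - x2 * w2)"
      using le by (rule mult_left_mono) simp
    also have "\<dots> < 1 * cmod (1 - x2 * w2)"
      using w \<open>1 - x2 * w2 \<noteq> 0\<close> by (intro mult_strict_right_mono) (auto simp: w_eq)
    finally show False by simp
  qed
  then have "cmod (x2 * w2) = 1"
    by (metis eq_iff_diff_eq_0 norm_one)
  moreover have "cmod (x2 * w2) \<le> 1 * cmod w2"
    unfolding norm_mult using x2 by (rule mult_right_mono) simp
  ultimately show False
    using w by (simp add: w_eq)
qed

text \<open>On each factor this is \<open>r * (1 - u) < 1 - r\<^sup>2 * u\<close> for \<open>0 \<le> u \<le> 1\<close>, the difference being
  \<open>(1 - r) * (1 + r * u)\<close>.\<close>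

lemma bidisc_weight_scaleR_less:
  assumes z: "z \<in> closed_bidisc" and r: "0 < r" "r < 1"
  shows "r * bidisc_weight z < bidisc_weight (r *\<^sub>R z)"
proof -
  define s t where "s = (cmod (fst z))\<^sup>2" and "t = (cmod (snd z))\<^sup>2"
  have st: "0 \<le> s" "s \<le> 1" "0 \<le> t" "t \<le> 1"
    using z by (auto simp: s_def t_def power_le_one)
  have less: "r * (1 - u) < 1 - r\<^sup>2 * u" if "0 \<le> u" "u \<le> 1" for u :: real
  proof -
    have "0 < (1 - r) * (1 + r * u)"
      using r that by (intro mult_pos_pos add_pos_nonneg) auto
    then show ?thesis by (simp add: power2_eq_square algebra_simps)
  qed
  have "r * bidisc_weight z = sqrt ((r * (1 - s)) * (r * (1 - t)))"
    using r by (simp add: bidisc_weight_def s_def t_def real_sqrt_mult)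
  also have "\<dots> < sqrt ((1 - r\<^sup>2 * s) * (1 - r\<^sup>2 * t))"
    using less st r by (intro real_sqrt_less_mono mult_strict_mono') auto
  also have "\<dots> = bidisc_weight (r *\<^sub>R z)"
    by (simp add: bidisc_weight_def s_def t_def power_mult_distrib)
  finally show ?thesis .
qed

text \<open>The gap of a point of the closure is nonnegative. Dilation moves the evaluation point of
  \<open>tetra_den\<close> into the open bidisc, where the weight has strictly increased. If the first coordinate is
  zero this gains nothing, and the strict inequality comes from the absence of zeros instead.\<close>

lemma hexa_dilate_closure_hexablock:
  assumes y: "y \<in> closure hexablock" and r: "0 < r" "r < 1"
  shows "hexa_dilate r y \<in> hexablock"
  unfolding hexablock_iff_gap_pos
proof
  fix z :: "complex \<times> complex" assume z: "z \<in> closed_bidisc"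
  have less1: "cmod (fst (r *\<^sub>R z)) < 1" "cmod (snd (r *\<^sub>R z)) < 1"
  proof -
    have "r * c < 1" if "c \<le> 1" for c :: real
      using mult_left_mono[OF that, of r] r by linarith
    then show "cmod (fst (r *\<^sub>R z)) < 1" "cmod (snd (r *\<^sub>R z)) < 1"
      using z r by auto
  qed
  have "closure hexablock \<subseteq> {y. 0 \<le> hexa_gap y (r *\<^sub>R z)}"
  proof (rule closure_minimal)
    show "hexablock \<subseteq> {y. 0 \<le> hexa_gap y (r *\<^sub>R z)}"
    proof
      fix x assume x: "x \<in> hexablock"
      have "r *\<^sub>R z \<in> closed_bidisc"
        using less1 unfolding mem_Times_iff mem_cball_0 by (intro conjI less_imp_le)
      then have "0 < hexa_gap x (r *\<^sub>R z)"
        by (rule bspec[OF iffD1[OF hexablock_iff_gap_pos x]])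
      then show "x \<in> {y. 0 \<le> hexa_gap y (r *\<^sub>R z)}"
        unfolding mem_Collect_eq by (rule less_imp_le)
    qed
    show "closed {y. 0 \<le> hexa_gap y (r *\<^sub>R z)}"
      unfolding hexa_gap_def tetra_den_def by (intro closed_Collect_le continuous_intros)
  qed
  with y have gap: "cmod (fst y) * bidisc_weight (r *\<^sub>R z) \<le> cmod (tetra_den y (r *\<^sub>R z))"
    by (auto simp: hexa_gap_def)
  have den: "0 < cmod (tetra_den y (r *\<^sub>R z))"
    using tetra_den_neq_0_closure_hexablock[OF y less1] by simp
  have "cmod (fst y) * (r * bidisc_weight z) < cmod (tetra_den y (r *\<^sub>R z))"
  proof (cases "fst y = 0")
    case False
    then have "cmod (fst y) * (r * bidisc_weight z) < cmod (fst y) * bidisc_weight (r *\<^sub>R z)"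
      using bidisc_weight_scaleR_less[OF z r] by simp
    with gap show ?thesis by linarith
  qed (use den in simp)
  then show "0 < hexa_gap (hexa_dilate r y) z"
    using r by (simp add: hexa_gap_def tetra_den_hexa_dilate mult_ac)
qed

lemma interior_closure_hexablock: "interior (closure hexablock) = hexablock"
proof
  show "interior (closure hexablock) \<subseteq> hexablock"
  proof
    fix y assume "y \<in> interior (closure hexablock)"
    then obtain t where t: "1 < t" "hexa_dilate t y \<in> interior (closure hexablock)"
      using open_hexa_dilate_outward[OF open_interior] by blast
    then have "hexa_dilate (1 / t) (hexa_dilate t y) \<in> hexablock"
      using interior_subset by (intro hexa_dilate_closure_hexablock) auto
    with t show "y \<in> hexablock"
      by (simp add: hexa_dilate_dilate)
  qed
  show "hexablock \<subseteq> interior (closure hexablock)"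
    by (intro interior_maximal closure_subset open_hexablock)
qed

section \<open>The structured singular value\<close>

lemma det_one_minus_mult_upper_triangular:
  assumes "X \<in> upper_triangular2"
  shows "det (mat 1 - A ** X) = tetra_den (pi_hexa A) (X$1$1, X$2$2) - A$2$1 * X$1$2"
  using assms
  by (simp add: det_2 matrix_matrix_mult_def mat_def UNIV_2 upper_triangular2_def pi_hexa_def
      algebra_simps)

text \<open>For given diagonal entries the corner entry \<open>q\<close> ranges over a full disc, whose radius is the
  weight. So a contraction annihilating the determinant exists iff \<open>a * q\<close> can reach the value of
  \<open>tetra_den\<close>, that is, iff the gap is nonpositive somewhere.\<close>

lemma upper_triangular_contractions_iff_hexablock:
  "(\<forall>X\<in>upper_triangular2. opnorm X \<le> 1 \<longrightarrow> det (mat 1 - A ** X) \<noteq> 0) \<longleftrightarrow> pi_hexa A \<in> hexablock"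
proof
  assume nz: "\<forall>X\<in>upper_triangular2. opnorm X \<le> 1 \<longrightarrow> det (mat 1 - A ** X) \<noteq> 0"
  show "pi_hexa A \<in> hexablock"
    unfolding hexablock_iff_gap_pos
  proof (rule ballI, rule ccontr)
    fix z assume z: "z \<in> closed_bidisc" and "\<not> 0 < hexa_gap (pi_hexa A) z"
    then have le: "cmod (tetra_den (pi_hexa A) z) \<le> cmod (A$2$1) * bidisc_weight z"
      by (simp add: hexa_gap_def pi_hexa_def)
    (* If A$2$1 = 0 then tetra_den vanishes at z, and the convention on division by zero gives
       q = 0, which is a correct choice. *)
    define q where "q = tetra_den (pi_hexa A) z / A$2$1"
    have q: "A$2$1 * q = tetra_den (pi_hexa A) z"
      using le by (cases "A$2$1 = 0") (auto simp: q_def)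
    have "cmod q \<le> bidisc_weight z"
      using le bidisc_weight_nonneg[OF z]
      by (cases "A$2$1 = 0") (auto simp: q_def norm_divide field_simps)
    then have "(cmod q)\<^sup>2 \<le> (bidisc_weight z)\<^sup>2"
      by (rule power_mono) simp
    also have "\<dots> = (1 - (cmod (fst z))\<^sup>2) * (1 - (cmod (snd z))\<^sup>2)"
      using z by (auto simp: bidisc_weight_def power_le_one)
    finally have q_le: "(cmod q)\<^sup>2 \<le> (1 - (cmod (fst z))\<^sup>2) * (1 - (cmod (snd z))\<^sup>2)" .
    define X :: "complex^2^2" where "X = vector [vector [fst z, q], vector [0, snd z]]"
    have X: "X \<in> upper_triangular2" "X$1$1 = fst z" "X$1$2 = q" "X$2$2 = snd z"
      by (simp_all add: X_def upper_triangular2_def)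
    have "opnorm X \<le> 1"
      unfolding upper_triangular_contraction_iff[OF X(1)] X using z q_le by auto
    moreover have "det (mat 1 - A ** X) = 0"
      unfolding det_one_minus_mult_upper_triangular[OF X(1)] X q by simp
    ultimately show False
      using nz X(1) by blast
  qed
next
  assume hexa: "pi_hexa A \<in> hexablock"
  show "\<forall>X\<in>upper_triangular2. opnorm X \<le> 1 \<longrightarrow> det (mat 1 - A ** X) \<noteq> 0"
  proof (intro ballI impI notI)
    fix X assume X: "X \<in> upper_triangular2" "opnorm X \<le> 1" "det (mat 1 - A ** X) = 0"
    let ?z = "(X$1$1, X$2$2)"
    have c: "cmod (X$1$1) \<le> 1" "cmod (X$2$2) \<le> 1"
        "(cmod (X$1$2))\<^sup>2 \<le> (1 - (cmod (X$1$1))\<^sup>2) * (1 - (cmod (X$2$2))\<^sup>2)"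
      using X upper_triangular_contraction_iff[OF X(1)] by auto
    then have "cmod (X$1$2) \<le> bidisc_weight ?z"
      by (auto simp: bidisc_weight_def intro: real_le_rsqrt)
    then have "cmod (A$2$1) * cmod (X$1$2) \<le> cmod (A$2$1) * bidisc_weight ?z"
      by (rule mult_left_mono) simp
    moreover have "cmod (tetra_den (pi_hexa A) ?z) = cmod (A$2$1) * cmod (X$1$2)"
      using X(3) by (simp add: det_one_minus_mult_upper_triangular[OF X(1)] flip: norm_mult)
    ultimately have "hexa_gap (pi_hexa A) ?z \<le> 0"
      by (simp add: hexa_gap_def pi_hexa_def)
    moreover have "?z \<in> closed_bidisc"
      using c by auto
    ultimately show False
      using hexa by (force simp: hexablock_iff_gap_pos)
  qed
qed

text \<open>That no annihilating \<open>X\<close> is a contraction has to be improved to an infimum strictly above 1, and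
  the dilation does this without showing that the infimum is attained: since the hexablock is open, a slightly enlarged \<open>t * A\<close> still maps into it, and every annihilating \<open>X\<close> then has norm
  at least \<open>t > 1\<close>.\<close>

lemma mu_hexa_less_1_iff: "mu_hexa A < 1 \<longleftrightarrow> pi_hexa A \<in> hexablock"
proof -
  define N where "N = {opnorm X | X. X \<in> upper_triangular2 \<and> det (mat 1 - A ** X) = 0}"
  show ?thesis
  proof (cases "N = {}")
    case True
    then have "\<forall>X\<in>upper_triangular2. det (mat 1 - A ** X) \<noteq> 0"
      by (auto simp: N_def)
    then show ?thesis
      using upper_triangular_contractions_iff_hexablock[of A] by (simp add: mu_hexa_def)
  next
    case False
    then have mu: "mu_hexa A = 1 / Inf N"
      by (auto simp: mu_hexa_def N_def)
    (* The infimum must be shown to be positive: otherwise its reciprocal would be 0. *)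
    have A_N: "1 \<le> opnorm A * x" if "x \<in> N" for x
      using that det_one_minus_mult_neq_0[of A] by (fastforce simp: N_def not_less[symmetric])
    have "opnorm A \<noteq> 0"
      using A_N False by fastforce
    then have A_pos: "0 < opnorm A"
      using opnorm_nonneg[of A] by simp
    have "1 / opnorm A \<le> Inf N"
      using False A_N A_pos by (intro cInf_greatest) (auto simp: field_simps)
    then have Inf_pos: "0 < Inf N"
      using A_pos by (auto intro: less_le_trans[of _ "1 / opnorm A"])
    have bdd: "bdd_below N"
      by (rule bdd_belowI[of _ 0]) (auto simp: N_def opnorm_nonneg)
    show ?thesis
    proof
      assume "mu_hexa A < 1"
      with Inf_pos have "1 < Inf N"
        by (simp add: mu)
      then have "1 < x" if "x \<in> N" for x
        using cInf_lower[OF that bdd] by simp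
      then have "\<forall>X\<in>upper_triangular2. opnorm X \<le> 1 \<longrightarrow> det (mat 1 - A ** X) \<noteq> 0"
        by (force simp: N_def)
      then show "pi_hexa A \<in> hexablock"
        by (simp add: upper_triangular_contractions_iff_hexablock)
    next
      assume "pi_hexa A \<in> hexablock"
      then obtain t where t: "1 < t" "pi_hexa (t *\<^sub>R A) \<in> hexablock"
        using open_hexa_dilate_outward[OF open_hexablock] by (metis pi_hexa_scaleR)
      have "t \<le> x" if "x \<in> N" for x
      proof (rule ccontr)
        assume "\<not> t \<le> x"
        with that obtain X where X: "X \<in> upper_triangular2" "det (mat 1 - A ** X) = 0" "opnorm X < t"
          by (auto simp: N_def)
        have "opnorm ((1 / t) *\<^sub>R X) \<le> 1" "(1 / t) *\<^sub>R X \<in> upper_triangular2"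
          using X t by (simp_all only: opnorm_scaleR) (auto simp: upper_triangular2_def)
        moreover have "(t *\<^sub>R A) ** ((1 / t) *\<^sub>R X) = A ** X"
          using t by (simp add: matrix_matrix_mult_def vec_eq_iff)
        ultimately show False
          using t(2) X(2) upper_triangular_contractions_iff_hexablock[of "t *\<^sub>R A"] by metis
      qed
      then have "t \<le> Inf N"
        using False by (intro cInf_greatest)
      with t show "mu_hexa A < 1"
        by (simp add: mu)
    qed
  qed
qed

section \<open>The two images in four-space\<close>

lemma range_pi_hexa: "(a, x1, x2, x3) \<in> range pi_hexa \<longleftrightarrow> a \<noteq> 0 \<or> x3 = x1 * x2"
proof
  assume "(a, x1, x2, x3) \<in> range pi_hexa"
  then show "a \<noteq> 0 \<or> x3 = x1 * x2"
    by (auto simp: pi_hexa_def det_2)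
next
  assume "a \<noteq> 0 \<or> x3 = x1 * x2"
  (* For a = 0 the upper right entry does not affect the image; division by zero makes it 0. *)
  then have "(a, x1, x2, x3) = pi_hexa (vector [vector [x1, (x1 * x2 - x3) / a], vector [a, x2]])"
    by (auto simp: pi_hexa_def det_2)
  then show "(a, x1, x2, x3) \<in> range pi_hexa"
    by (rule range_eqI)
qed

lemma pi_hexa_inj:
  assumes "pi_hexa A = pi_hexa B" "A$2$1 \<noteq> 0"
  shows "A = B"
  using assms by (auto simp: pi_hexa_def det_2 vec_eq_iff forall_2)

text \<open>On the hyperplane where the first coordinate is zero, the range is cut out by \<open>x3 = x1 * x2\<close>, so
  an arbitrarily small change of \<open>x3\<close> leaves it.\<close>

lemma fst_interior_range_pi_hexa:
  assumes "y \<in> interior (range pi_hexa)"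
  shows "fst y \<noteq> 0"
proof
  obtain a x1 x2 x3 where y: "y = (a, x1, x2, x3)"
    by (cases y)
  assume "fst y = 0"
  then have a: "a = 0" by (simp add: y)
  have "((\<lambda>e. (0, x1, x2, x3 + of_real e)) \<longlongrightarrow> (0, x1, x2, x3 + of_real 0)) (at_right 0)"
    by (intro tendsto_intros)
  then have "\<forall>\<^sub>F e in at_right 0. (0, x1, x2, x3 + of_real e) \<in> interior (range pi_hexa)"
    using assms by (auto simp: y a dest: topological_tendstoD[OF _ open_interior])
  then have "\<forall>\<^sub>F e in at_right 0. x3 + of_real e = x1 * x2"
    by eventually_elim (use subsetD[OF interior_subset] range_pi_hexa in blast)
  moreover have "x3 = x1 * x2"
    using subsetD[OF interior_subset assms] range_pi_hexa[of 0 x1 x2 x3] by (simp add: y a)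
  ultimately have "\<forall>\<^sub>F e in at_right (0::real). e = 0"
    by simp
  moreover have "\<forall>\<^sub>F e in at_right (0::real). 0 < e"
    by (simp add: eventually_at_right_less)
  ultimately have "\<forall>\<^sub>F e in at_right (0::real). False"
    by eventually_elim simp
  then show False by simp
qed

lemma H_mu_eq: "H_mu = hexablock \<inter> range pi_hexa"
  by (auto simp: H_mu_def mu_hexa_less_1_iff)

lemma interior_H_mu: "interior H_mu = {y \<in> hexablock. fst y \<noteq> 0}"
proof
  show "interior H_mu \<subseteq> {y \<in> hexablock. fst y \<noteq> 0}"
    unfolding H_mu_eq interior_Int using fst_interior_range_pi_hexa interior_subset by blast
  have "open (hexablock \<inter> {y. fst y \<noteq> 0})"
    by (intro open_Int open_hexablock open_Collect_neq continuous_intros)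
  moreover have "hexablock \<inter> {y. fst y \<noteq> 0} \<subseteq> H_mu"
    by (auto simp: H_mu_eq range_pi_hexa)
  ultimately show "{y \<in> hexablock. fst y \<noteq> 0} \<subseteq> interior H_mu"
    by (simp add: interior_maximal Collect_conj_eq)
qed

lemma closure_H_mu: "closure H_mu = closure hexablock"
proof
  show "closure H_mu \<subseteq> closure hexablock"
    by (intro closure_mono) (auto simp: H_mu_eq)
  have "y \<in> closure H_mu" if y: "y \<in> hexablock" for y
  proof (cases "fst y = 0")
    case True
    obtain x where y_eq: "y = (0, x)"
      using True by (cases y) auto
    have lim: "((\<lambda>e. (complex_of_real e, x)) \<longlongrightarrow> (of_real 0, x)) (at_right 0)"
      by (intro tendsto_intros)
    then have "\<forall>\<^sub>F e in at_right 0. (complex_of_real e, x) \<in> hexablock"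
      using y by (auto simp: y_eq dest: topological_tendstoD[OF _ open_hexablock])
    moreover have "\<forall>\<^sub>F e in at_right (0::real). 0 < e"
      by (simp add: eventually_at_right_less)
    ultimately have "\<forall>\<^sub>F e in at_right 0. (complex_of_real e, x) \<in> interior H_mu"
      by eventually_elim (simp add: interior_H_mu)
    then have "\<forall>\<^sub>F e in at_right 0. (complex_of_real e, x) \<in> closure H_mu"
      by eventually_elim (rule subsetD[OF order_trans[OF interior_subset closure_subset]])
    from Lim_in_closed_set[OF closed_closure this _ lim] show ?thesis
      by (simp add: y_eq)
  next
    case False
    with y have "y \<in> interior H_mu"
      by (simp add: interior_H_mu)
    then show ?thesis
      by (rule subsetD[OF order_trans[OF interior_subset closure_subset]])
  qed
  then show "closure hexablock \<subseteq> closure H_mu"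
    by (intro closure_minimal) auto
qed

lemma H_N_subset_H_mu: "H_N \<subseteq> H_mu"
proof -
  have "pi_hexa A \<in> hexablock" if "opnorm A < 1" for A
    unfolding upper_triangular_contractions_iff_hexablock[symmetric]
  proof (intro ballI impI det_one_minus_mult_neq_0)
    fix X assume "opnorm X \<le> 1"
    then have "opnorm A * opnorm X \<le> opnorm A * 1"
      by (intro mult_left_mono opnorm_nonneg)
    with that show "opnorm A * opnorm X < 1" by simp
  qed
  then show ?thesis
    by (auto simp: H_N_def H_mu_eq)
qed

text \<open>The closed unit ball of the operator norm is compact, so its image is closed.\<close>

lemma closure_H_N_subset: "closure H_N \<subseteq> pi_hexa ` {A. opnorm A \<le> 1}"
proof (rule closure_minimal)
  show "H_N \<subseteq> pi_hexa ` {A. opnorm A \<le> 1}"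
    by (auto simp: H_N_def)
  have "continuous_on UNIV pi_hexa"
    unfolding pi_hexa_def det_2 by (intro continuous_intros)
  then have "continuous_on {A. opnorm A \<le> 1} pi_hexa"
    by (rule continuous_on_subset) simp
  then show "closed (pi_hexa ` {A. opnorm A \<le> 1})"
    by (intro compact_imp_closed compact_continuous_image compact_opnorm_cball)
qed

text \<open>At an interior point the first coordinate is nonzero, so that the matrix is determined by its
  image. A dilated point is the image of a contraction, and this contraction can only be the scaled
  matrix.\<close>

lemma interior_closure_H_N: "interior (closure H_N) = interior H_N"
proof
  have "y \<in> H_N" if y: "y \<in> interior (closure H_N)" for y
  proof -
    have "y \<in> interior (range pi_hexa)"
      using y closure_H_N_subset interior_mono[of "closure H_N" "range pi_hexa"] by blast
    then have fst_y: "fst y \<noteq> 0"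
      by (rule fst_interior_range_pi_hexa)
    obtain A where A: "y = pi_hexa A"
      using y closure_H_N_subset interior_subset by blast
    obtain t where t: "1 < t" "hexa_dilate t y \<in> interior (closure H_N)"
      using open_hexa_dilate_outward[OF open_interior y] .
    then obtain B where B: "pi_hexa B = pi_hexa (t *\<^sub>R A)" "opnorm B \<le> 1"
      using closure_H_N_subset interior_subset
      by (metis (no_types, lifting) A imageE mem_Collect_eq pi_hexa_scaleR subsetD)
    have "t *\<^sub>R A = B"
    proof (rule pi_hexa_inj)
      show "pi_hexa (t *\<^sub>R A) = pi_hexa B"
        by (simp only: B(1))
      show "(t *\<^sub>R A)$2$1 \<noteq> 0"
        using t(1) fst_y by (simp add: A pi_hexa_def)
    qed
    then have "t * opnorm A \<le> 1"
      using B(2) t(1) opnorm_scaleR[of t A] by simp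
    then have "opnorm A \<le> 1 / t"
      using t(1) by (simp add: field_simps)
    also have "\<dots> < 1"
      using t(1) by simp
    finally have "opnorm A < 1" .
    then show ?thesis
      by (auto simp: H_N_def A)
  qed
  then show "interior (closure H_N) \<subseteq> interior H_N"
    by (intro interior_maximal) auto
  show "interior H_N \<subseteq> interior (closure H_N)"
    by (intro interior_mono closure_subset)
qed

text \<open>The only matrix over this point has upper right entry \<open>- 2\<close>. The gap is at least
  \<open>(1 - 1/2) - 1/4\<close>.\<close>

lemma interior_H_mu_not_in_H_N: "(1/4, 0, 0, 1/2) \<in> interior H_mu - H_N"
proof -
  have "(1/4, 0, 0, 1/2) \<in> hexablock"
    unfolding hexablock_iff_gap_pos
  proof safe
    fix z1 z2 :: complex assume z: "z1 \<in> cball 0 1" "z2 \<in> cball 0 1"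
    then have "cmod z1 * cmod z2 \<le> 1 * 1"
      by (intro mult_mono) auto
    then have "1 / 2 \<le> 1 - cmod (z1 * z2 / 2)"
      by (simp add: norm_mult norm_divide)
    also have "\<dots> \<le> cmod (1 + z1 * z2 / 2)"
      using norm_triangle_ineq4[of "1 + z1 * z2 / 2" "z1 * z2 / 2"] by simp
    finally have "1 / 2 \<le> cmod (tetra_den (1/4, 0, 0, 1/2) (z1, z2))"
      by simp
    moreover have "(1 - (cmod z1)\<^sup>2) * (1 - (cmod z2)\<^sup>2) \<le> 1 * 1"
      using z by (intro mult_mono) (auto simp: power_le_one)
    then have "bidisc_weight (z1, z2) \<le> 1"
      by (simp add: bidisc_weight_def)
    ultimately show "0 < hexa_gap (1/4, 0, 0, 1/2) (z1, z2)"
      by (simp add: hexa_gap_def)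
  qed
  moreover have "(1/4, 0, 0, 1/2) \<notin> H_N"
  proof
    assume "(1/4, 0, 0, 1/2) \<in> H_N"
    then obtain A where A: "pi_hexa A = (1/4, 0, 0, 1/2)" "opnorm A < 1"
      by (auto simp: H_N_def)
    then have A': "A$2$1 = 1/4" "A$1$1 = 0" "A$2$2 = 0" "det A = 1/2"
      by (simp_all add: pi_hexa_def)
    have "A$1$2 = - 4 * det A"
      unfolding det_2 A'(1-3) by simp
    then have "A$1$2 = - 2"
      by (simp add: A')
    have "2 \<le> norm (A *v axis 2 1)"
      using Finite_Cartesian_Product.norm_nth_le[of "A *v axis 2 1" 1] \<open>A$1$2 = - 2\<close>
      by (simp add: matrix_vector_mult_def axis_def UNIV_2)
    also have "\<dots> \<le> opnorm A"
      using norm_mult_vec_le[of A "axis 2 1"] by simp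
    finally show False
      using A(2) by simp
  qed
  ultimately show ?thesis
    by (simp add: interior_H_mu)
qed

theorem proposition5p14:
  shows "interior (closure H_N) = interior H_N
    \<and> interior H_N \<subset> interior H_mu
    \<and> interior H_mu \<subset> interior (closure H_mu)
    \<and> interior (closure H_mu) = hexablock"
proof (intro conjI)
  show "interior (closure H_N) = interior H_N"
    by (rule interior_closure_H_N)
  show "interior H_N \<subset> interior H_mu"
    using interior_mono[OF H_N_subset_H_mu] interior_H_mu_not_in_H_N interior_subset by blast
  show hexa: "interior (closure H_mu) = hexablock"
    by (simp add: closure_H_mu interior_closure_hexablock)
  (* The origin has first coordinate zero. *)
  have "(0, 0, 0, 0) \<in> hexablock"
    by (auto simp: hexablock_iff_gap_pos hexa_gap_def)
  then show "interior H_mu \<subset> interior (closure H_mu)"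
    unfolding hexa interior_H_mu by force
qed

end
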